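(* Let $\tau_*$ be the essential supremum of all approachable times and let $\rho^*$ be the essential infimum of the delimiting set $\mathbb D$. Then $\rho^*=\tau_*$.
   Context: Setting. $(\Omega,\mathcal F,\mathbb P)$ is a probability space, $\mathbb T\subset[0,\infty)$ is a general set of time points (discrete, continuous or hybrid) with $0\in\mathbb T$, $T=\sup\mathbb T\in[0,+\infty]$, and $\{\mathcal F_t\}_{t\in\mathbb T}$ is a right-continuous filtration. For a stopping time $\rho$, $\mathcal T(\rho)$ is the set of stopping times $\tau\ge\rho$; thus $\mathcal T(0)$ is the set of all stopping times, and the constant $T$ belongs to it. Stopping times that are a.s. equal are identified and inequalities between them are understood a.s. For every $t\in\mathbb T$ a preference is given: a map $J(\cdot;t):\mathcal T(t)\to L^0(\Omega,\mathcal F_t,\mathbb R)$ (so $J(\tau;t)$ is $\mathcal F_t$-measurable) such that $J(\tau_1;t)=J(\tau_2;t)$ if $\tau_1=\tau_2$ a.s. The map $F$. For $\rho\in\mathcal T(0)$, $F(\rho)=\inf\{t<\rho:\ J(t;t)>J(\tau;t)\ \text{for all stopping times }\tau\text{ with }t<\tau\le\rho\}\wedge\rho$, read $\omega$ by $\omega$: a time $t\in\mathbb T$ with $t<\rho(\omega)$ is in the set iff $J(t;t)(\omega)>J(\tau;t)(\omega)$ for every $\tau\in\mathcal T(t)$ with $\tau\le\rho\vee t$ and $\tau(\omega)>t$. With the filtration right continuous, $F(\rho)$ is a stopping time, so $F:\mathcal T(0)\to\mathcal T(0)$. A stopping time $\tau$ is approachable if $F(\tau)=\tau$. A subset $\mathbb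 B\subset\mathcal T(0)$ is admissible if (i) $T\in\mathbb B$; (ii) $\rho\in\mathbb B$ implies $F(\rho)\in\mathbb B$; (iii) for any totally ordered (w.r.t. $\le$) subset of $\mathbb B$, its essential infimum is an element of $\mathbb B$. The delimiting set $\mathbb D$ is the intersection of all admissible sets. *)

theory Defs
  imports "HOL-Probability.Probability"
begin

definition horizon :: "real set \<Rightarrow> ereal" where
  "horizon TT = (SUP t\<in>TT. ereal t)"

text \<open>Possible values of a stopping time: the horizon, and all infima of nonempty sets of time
  points. If \<open>TT\<close> contains the limits of its decreasing sequences, this is just \<open>TT\<close> together with
  the horizon; otherwise the infima have to be added, because infima of stopping times (and of sets
  of time points) attain them.\<close>

definition time_values :: "real set \<Rightarrow> ereal set" where
  "time_values TT = insert (horizon TT) {Inf (ereal ` S) | S. S \<noteq> {} \<and> S \<subseteq> TT}"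

definition filtration_on :: "'a measure \<Rightarrow> real set \<Rightarrow> (real \<Rightarrow> 'a measure) \<Rightarrow> bool" where
  "filtration_on M TT Fil \<longleftrightarrow>
     (\<forall>t\<in>TT. subalgebra M (Fil t)) \<and>
     (\<forall>s\<in>TT. \<forall>t\<in>TT. s \<le> t \<longrightarrow> subalgebra (Fil t) (Fil s))"

text \<open>Right continuity is a condition only at those time points that are limits of later time
  points; at a time point isolated from the right the right limit of the filtration is \<open>Fil t\<close>
  itself.\<close>

definition right_continuous_filtration :: "real set \<Rightarrow> (real \<Rightarrow> 'a measure) \<Rightarrow> bool" where
  "right_continuous_filtration TT Fil \<longleftrightarrow>
     (\<forall>t\<in>TT. (\<forall>e>0. \<exists>s\<in>TT. t < s \<and> s < t + e) \<longrightarrow>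
        (\<Inter>s\<in>{s\<in>TT. t < s}. sets (Fil s)) = sets (Fil t))"

definition stopping_times :: "'a measure \<Rightarrow> real set \<Rightarrow> (real \<Rightarrow> 'a measure) \<Rightarrow> ('a \<Rightarrow> ereal) set" where
  "stopping_times M TT Fil =
     {\<tau> \<in> borel_measurable M.
        (\<forall>\<omega>\<in>space M. \<tau> \<omega> \<in> time_values TT) \<and>
        (\<forall>t\<in>TT. {\<omega>\<in>space M. \<tau> \<omega> \<le> ereal t} \<in> sets (Fil t))}"

text \<open>Stopping times are kept as functions. Their identification up to almost sure equality is
  rendered by comparing them almost surely throughout, and by asking sets of stopping times to be
  closed under almost sure equality.\<close>

definition stopping_times_from ::
  "'a measure \<Rightarrow> real set \<Rightarrow> (real \<Rightarrow> 'a measure) \<Rightarrow> ('a \<Rightarrow> ereal) \<Rightarrow> ('a \<Rightarrow> ereal) set" where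
  "stopping_times_from M TT Fil \<rho> =
     {\<tau> \<in> stopping_times M TT Fil. AE \<omega> in M. \<rho> \<omega> \<le> \<tau> \<omega>}"

text \<open>\<open>J \<tau> t\<close> stands for $J(\tau;t)$; equality in $L^0$ is almost sure equality.\<close>

definition preference ::
  "'a measure \<Rightarrow> real set \<Rightarrow> (real \<Rightarrow> 'a measure) \<Rightarrow> (('a \<Rightarrow> ereal) \<Rightarrow> real \<Rightarrow> 'a \<Rightarrow> real) \<Rightarrow> bool" where
  "preference M TT Fil J \<longleftrightarrow>
     (\<forall>t\<in>TT.
        (\<forall>\<tau>\<in>stopping_times_from M TT Fil (\<lambda>_. ereal t). J \<tau> t \<in> borel_measurable (Fil t)) \<and>
        (\<forall>\<tau>1\<in>stopping_times_from M TT Fil (\<lambda>_. ereal t).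
         \<forall>\<tau>2\<in>stopping_times_from M TT Fil (\<lambda>_. ereal t).
           (AE \<omega> in M. \<tau>1 \<omega> = \<tau>2 \<omega>) \<longrightarrow> (AE \<omega> in M. J \<tau>1 t \<omega> = J \<tau>2 t \<omega>)))"

text \<open>The map $F$. As \<open>Inf {} = \<infinity>\<close>, its value is \<open>\<rho> \<omega>\<close> when no time point qualifies.\<close>

definition stop_map ::
  "'a measure \<Rightarrow> real set \<Rightarrow> (real \<Rightarrow> 'a measure) \<Rightarrow> (('a \<Rightarrow> ereal) \<Rightarrow> real \<Rightarrow> 'a \<Rightarrow> real) \<Rightarrow>
     ('a \<Rightarrow> ereal) \<Rightarrow> 'a \<Rightarrow> ereal" where
  "stop_map M TT Fil J \<rho> \<omega> =
     min (Inf {ereal t | t. t \<in> TT \<and> ereal t < \<rho> \<omega> \<and>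
            (\<forall>\<tau>\<in>stopping_times_from M TT Fil (\<lambda>_. ereal t).
               (AE \<omega>' in M. \<tau> \<omega>' \<le> max (\<rho> \<omega>') (ereal t)) \<and> ereal t < \<tau> \<omega> \<longrightarrow>
               J (\<lambda>_. ereal t) t \<omega> > J \<tau> t \<omega>)})
         (\<rho> \<omega>)"

definition approachable_times ::
  "'a measure \<Rightarrow> real set \<Rightarrow> (real \<Rightarrow> 'a measure) \<Rightarrow> (('a \<Rightarrow> ereal) \<Rightarrow> real \<Rightarrow> 'a \<Rightarrow> real) \<Rightarrow>
     ('a \<Rightarrow> ereal) set" where
  "approachable_times M TT Fil J =
     {\<tau> \<in> stopping_times M TT Fil. AE \<omega> in M. stop_map M TT Fil J \<tau> \<omega> = \<tau> \<omega>}"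

text \<open>Essential infimum and supremum of a family of random variables; the library notion of
  essential supremum concerns a single function.\<close>

definition is_ess_inf :: "'a measure \<Rightarrow> ('a \<Rightarrow> ereal) set \<Rightarrow> ('a \<Rightarrow> ereal) \<Rightarrow> bool" where
  "is_ess_inf M C X \<longleftrightarrow>
     X \<in> borel_measurable M \<and>
     (\<forall>Z\<in>C. AE \<omega> in M. X \<omega> \<le> Z \<omega>) \<and>
     (\<forall>Y\<in>borel_measurable M. (\<forall>Z\<in>C. AE \<omega> in M. Y \<omega> \<le> Z \<omega>) \<longrightarrow> (AE \<omega> in M. Y \<omega> \<le> X \<omega>))"

definition is_ess_sup :: "'a measure \<Rightarrow> ('a \<Rightarrow> ereal) set \<Rightarrow> ('a \<Rightarrow> ereal) \<Rightarrow> bool" where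
  "is_ess_sup M C X \<longleftrightarrow>
     X \<in> borel_measurable M \<and>
     (\<forall>Z\<in>C. AE \<omega> in M. Z \<omega> \<le> X \<omega>) \<and>
     (\<forall>Y\<in>borel_measurable M. (\<forall>Z\<in>C. AE \<omega> in M. Z \<omega> \<le> Y \<omega>) \<longrightarrow> (AE \<omega> in M. X \<omega> \<le> Y \<omega>))"

definition ess_inf :: "'a measure \<Rightarrow> ('a \<Rightarrow> ereal) set \<Rightarrow> 'a \<Rightarrow> ereal" where
  "ess_inf M C = (SOME X. is_ess_inf M C X)"

definition ess_sup :: "'a measure \<Rightarrow> ('a \<Rightarrow> ereal) set \<Rightarrow> 'a \<Rightarrow> ereal" where
  "ess_sup M C = (SOME X. is_ess_sup M C X)"

definition totally_ordered_ae :: "'a measure \<Rightarrow> ('a \<Rightarrow> ereal) set \<Rightarrow> bool" where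
  "totally_ordered_ae M C \<longleftrightarrow>
     (\<forall>\<sigma>\<in>C. \<forall>\<tau>\<in>C. (AE \<omega> in M. \<sigma> \<omega> \<le> \<tau> \<omega>) \<or> (AE \<omega> in M. \<tau> \<omega> \<le> \<sigma> \<omega>))"

text \<open>The second line makes \<open>B\<close> a set of classes of almost surely equal stopping times; hence the
  last two conditions only need to name one representative. Among stopping times the infimum of the
  empty family is the horizon, which is in \<open>B\<close> anyway, whereas \<open>is_ess_inf\<close> would yield \<open>\<infinity>\<close>;
  therefore the last condition is about nonempty families.\<close>

definition admissible ::
  "'a measure \<Rightarrow> real set \<Rightarrow> (real \<Rightarrow> 'a measure) \<Rightarrow> (('a \<Rightarrow> ereal) \<Rightarrow> real \<Rightarrow> 'a \<Rightarrow> real) \<Rightarrow>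
     ('a \<Rightarrow> ereal) set \<Rightarrow> bool" where
  "admissible M TT Fil J B \<longleftrightarrow>
     B \<subseteq> stopping_times M TT Fil \<and>
     (\<forall>\<sigma>\<in>B. \<forall>\<tau>\<in>stopping_times M TT Fil. (AE \<omega> in M. \<tau> \<omega> = \<sigma> \<omega>) \<longrightarrow> \<tau> \<in> B) \<and>
     (\<lambda>_. horizon TT) \<in> B \<and>
     (\<forall>\<rho>\<in>B. \<exists>\<sigma>\<in>B. AE \<omega> in M. \<sigma> \<omega> = stop_map M TT Fil J \<rho> \<omega>) \<and>
     (\<forall>C. C \<subseteq> B \<and> C \<noteq> {} \<and> totally_ordered_ae M C \<longrightarrow> (\<exists>\<sigma>\<in>B. is_ess_inf M C \<sigma>))"

definition delimiting_set ::
  "'a measure \<Rightarrow> real set \<Rightarrow> (real \<Rightarrow> 'a measure) \<Rightarrow> (('a \<Rightarrow> ereal) \<Rightarrow> real \<Rightarrow> 'a \<Rightarrow> real) \<Rightarrow>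
     ('a \<Rightarrow> ereal) set" where
  "delimiting_set M TT Fil J = \<Inter>{B. admissible M TT Fil J B}"

end

theory Submission imports Defs begin

text \<open>
  The map \<open>F\<close> is deflationary, \<open>F \<rho> \<le> \<rho>\<close>, and monotone: a smaller \<open>\<rho>\<close> leaves fewer competitors
  \<open>\<tau>\<close> with \<open>t < \<tau> \<le> \<rho>\<close>, so every time \<open>t < \<sigma>\<close> that qualifies for a larger \<open>\<rho>\<close> also qualifies
  for \<open>\<sigma> \<le> \<rho>\<close> (\<open>stop_map_mono\<close>). The theorem is therefore an instance of the Zermelo and
  Bourbaki-Witt way of reaching the greatest fixed point of a monotone map by iterating it downwards
  from the top, here the horizon; \<open>\<D>\<close> is the orbit of that transfinite iteration.

  An approachable \<open>\<tau>\<close> lies below the whole of \<open>\<D>\<close>: the stopping times above \<open>\<tau>\<close> form an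
  admissible set, because \<open>\<tau> \<le> \<rho>\<close> gives \<open>\<tau> = F \<tau> \<le> F \<rho>\<close>. On the other hand \<open>\<D>\<close> is totally
  ordered (\<open>delimiting_chain\<close>), so it contains its essential infimum \<open>\<rho>*\<close>, and then \<open>F \<rho>*\<close>, which
  is again in \<open>\<D>\<close>, cannot lie below \<open>\<rho>*\<close>: \<open>\<rho>*\<close> is approachable. Thus \<open>\<rho>*\<close> is the largest
  approachable time, in particular the essential supremum of all of them.

  For \<open>\<D>\<close> to be a set of stopping times at all, some admissible set has to exist. The set of all
  stopping times is one: the essential infimum of a chain is the infimum of a sequence from the
  chain (\<open>chain_ess_inf_sequence\<close>), and right continuity of the filtration makes the infimum of a
  sequence of stopping times a stopping time (\<open>stopping_time_INF\<close>).
\<close>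

section \<open>Essential infima of chains\<close>

lemma is_ess_inf_unique:
  assumes "is_ess_inf M C X" "is_ess_inf M C Y"
  shows "AE \<omega> in M. X \<omega> = Y \<omega>"
proof -
  have "AE \<omega> in M. X \<omega> \<le> Y \<omega>" "AE \<omega> in M. Y \<omega> \<le> X \<omega>"
    using assms unfolding is_ess_inf_def by blast+
  then show ?thesis by eventually_elim simp
qed

lemma is_ess_sup_unique:
  assumes "is_ess_sup M C X" "is_ess_sup M C Y"
  shows "AE \<omega> in M. X \<omega> = Y \<omega>"
proof -
  have "AE \<omega> in M. X \<omega> \<le> Y \<omega>" "AE \<omega> in M. Y \<omega> \<le> X \<omega>"
    using assms unfolding is_ess_sup_def by blast+
  then show ?thesis by eventually_elim simp
qed

text \<open>The values \<open>\<plusminus>2\<close> at \<open>\<plusminus>\<infinity>\<close> lie strictly beyond the range of the arctangent, as \<open>\<pi> / 2 < 2\<close>.\<close>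

definition ereal_arctan :: "ereal \<Rightarrow> real" where
  "ereal_arctan x = (if x = \<infinity> then 2 else if x = -\<infinity> then -2 else arctan (real_of_ereal x))"

lemma abs_arctan_less_2: "\<bar>arctan x\<bar> < 2"
  using arctan_bounded[of x] pi_less_4 by linarith

lemma ereal_arctan_strict_mono: "strict_mono ereal_arctan"
proof (rule strict_monoI)
  fix x y :: ereal assume "x < y"
  moreover have "- 2 < arctan r" "arctan r < 2" for r
    using abs_arctan_less_2[of r] by linarith+
  ultimately show "ereal_arctan x < ereal_arctan y"
    by (cases x; cases y) (auto simp: ereal_arctan_def arctan_less_iff)
qed

lemma ereal_arctan_le_iff: "ereal_arctan x \<le> ereal_arctan y \<longleftrightarrow> x \<le> y"
  using ereal_arctan_strict_mono by (rule strict_mono_less_eq)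

lemma ereal_arctan_eq_iff: "ereal_arctan x = ereal_arctan y \<longleftrightarrow> x = y"
  using ereal_arctan_strict_mono by (rule strict_mono_eq)

lemma ereal_arctan_measurable [measurable]: "ereal_arctan \<in> borel_measurable borel"
proof -
  have [measurable]: "arctan \<in> borel_measurable borel"
    by (intro borel_measurable_continuous_onI continuous_intros)
  show ?thesis unfolding ereal_arctan_def by measurable
qed

lemma abs_ereal_arctan_le_2: "\<bar>ereal_arctan x\<bar> \<le> 2"
  using abs_arctan_less_2[of "real_of_ereal x"] by (auto simp: ereal_arctan_def)

text \<open>A sequence from the chain along which the mean of a bounded increasing transform tends to its
  infimum over the chain determines the essential infimum: a member \<open>Z\<close> that is not above one of
  the terms is below all of them, hence below their infimum, but its mean is not smaller, so that
  \<open>Z\<close> equals that infimum.\<close>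

lemma chain_ess_inf_sequence:
  assumes "prob_space M" and meas: "C \<subseteq> borel_measurable M" and "C \<noteq> {}"
    and chain: "totally_ordered_ae M C"
  obtains X :: "nat \<Rightarrow> 'a \<Rightarrow> ereal"
    where "range X \<subseteq> C" "is_ess_inf M C (\<lambda>\<omega>. INF n. X n \<omega>)"
proof -
  interpret prob_space M by fact
  define v where "v f = (\<integral>\<omega>. ereal_arctan (f \<omega>) \<partial>M)" for f
  have int: "integrable M (\<lambda>\<omega>. ereal_arctan (f \<omega>))" if "f \<in> borel_measurable M" for f
    using that abs_ereal_arctan_le_2
    by (intro integrable_const_bound[where B = 2]) auto
  have mono: "v f \<le> v g"
    if "f \<in> borel_measurable M" "g \<in> borel_measurable M" "AE \<omega> in M. f \<omega> \<le> g \<omega>" for f g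
    unfolding v_def using that(3)
    by (intro integral_mono_AE int that(1,2)) (auto simp: ereal_arctan_le_iff)
  have "-2 \<le> v f" if "f \<in> borel_measurable M" for f
  proof -
    have "-2 \<le> ereal_arctan x" for x using abs_ereal_arctan_le_2[of x] by linarith
    then have "(\<integral>\<omega>. -2 \<partial>M) \<le> v f"
      unfolding v_def by (intro integral_mono int that) auto
    then show ?thesis by (simp add: prob_space)
  qed
  then have bdd: "bdd_below (v ` C)" using meas by (auto intro!: bdd_belowI[where m = "-2"])
  have "\<exists>c\<in>C. v c < (INF c\<in>C. v c) + inverse (real (Suc n))" for n
    using cINF_less_iff[OF \<open>C \<noteq> {}\<close> bdd, of "(INF c\<in>C. v c) + inverse (real (Suc n))"] by simp
  then have "\<forall>n. \<exists>c. c \<in> C \<and> v c < (INF c\<in>C. v c) + inverse (real (Suc n))" by blast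
  from choice[OF this] obtain X where X: "\<And>n. X n \<in> C"
    "\<And>n. v (X n) < (INF c\<in>C. v c) + inverse (real (Suc n))" by blast
  define Y where "Y \<omega> = (INF n. X n \<omega>)" for \<omega>
  have X_meas [measurable]: "X n \<in> borel_measurable M" for n using X(1) meas by auto
  have Y_meas [measurable]: "Y \<in> borel_measurable M" unfolding Y_def by measurable
  have Y_le: "Y \<omega> \<le> X n \<omega>" for n \<omega> unfolding Y_def by (rule INF_lower) simp
  have "AE \<omega> in M. Y \<omega> \<le> Z \<omega>" if "Z \<in> C" for Z
  proof (cases "\<exists>n. AE \<omega> in M. X n \<omega> \<le> Z \<omega>")
    case True
    then obtain n where "AE \<omega> in M. X n \<omega> \<le> Z \<omega>" ..
    then show ?thesis by eventually_elim (use Y_le order_trans in blast)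
  next
    case False
    then have "AE \<omega> in M. Z \<omega> \<le> X n \<omega>" for n
      using chain that X(1) unfolding totally_ordered_ae_def by blast
    then have "AE \<omega> in M. \<forall>n. Z \<omega> \<le> X n \<omega>" by (simp add: AE_all_countable)
    then have ZY: "AE \<omega> in M. Z \<omega> \<le> Y \<omega>"
      unfolding Y_def by eventually_elim (auto intro: INF_greatest)
    have Z_meas [measurable]: "Z \<in> borel_measurable M" using that meas by auto
    have "v Y \<le> v (X n)" for n by (intro mono Y_meas X_meas AE_I2 Y_le)
    then have approx: "v Y \<le> (INF c\<in>C. v c) + inverse (real (Suc n))" for n
      using X(2)[of n] by (meson less_imp_le order_trans)
    have "v Y \<le> (INF c\<in>C. v c)"
    proof (rule field_le_epsilon)
      fix e :: real assume "e > 0"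
      then obtain n where "inverse (real (Suc n)) < e" using reals_Archimedean by blast
      with approx[of n] show "v Y \<le> (INF c\<in>C. v c) + e" by linarith
    qed
    also have "\<dots> \<le> v Z" by (rule cINF_lower[OF bdd that])
    finally have "v Y \<le> v Z" .
    with mono[OF Z_meas Y_meas ZY] have "(\<integral>\<omega>. ereal_arctan (Y \<omega>) - ereal_arctan (Z \<omega>) \<partial>M) = 0"
      using int[OF Y_meas] int[OF Z_meas] by (simp add: v_def)
    moreover have "AE \<omega> in M. 0 \<le> ereal_arctan (Y \<omega>) - ereal_arctan (Z \<omega>)"
      using ZY by eventually_elim (simp add: ereal_arctan_le_iff)
    moreover have "integrable M (\<lambda>\<omega>. ereal_arctan (Y \<omega>) - ereal_arctan (Z \<omega>))"
      by (intro Bochner_Integration.integrable_diff int Y_meas Z_meas)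
    ultimately have "AE \<omega> in M. ereal_arctan (Y \<omega>) - ereal_arctan (Z \<omega>) = 0"
      by (simp only: integral_nonneg_eq_0_iff_AE)
    then show ?thesis by eventually_elim (simp add: ereal_arctan_eq_iff)
  qed
  moreover have "AE \<omega> in M. W \<omega> \<le> Y \<omega>" if "\<forall>Z\<in>C. AE \<omega> in M. W \<omega> \<le> Z \<omega>" for W
  proof -
    have "AE \<omega> in M. \<forall>n. W \<omega> \<le> X n \<omega>" using that X(1) by (simp add: AE_all_countable)
    then show ?thesis unfolding Y_def by eventually_elim (auto intro: INF_greatest)
  qed
  ultimately have "is_ess_inf M C Y" using Y_meas unfolding is_ess_inf_def by blast
  then show thesis using X(1) by (intro that[of X]) (auto simp: Y_def[abs_def])
qed

section \<open>Stopping times and their infima\<close>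

lemma stopping_times_measurable: "\<tau> \<in> stopping_times M TT Fil \<Longrightarrow> \<tau> \<in> borel_measurable M"
  by (simp add: stopping_times_def)

lemma time_values_le_horizon:
  assumes "x \<in> time_values TT"
  shows "x \<le> horizon TT"
proof (cases "x = horizon TT")
  case False
  then obtain S s where "x = Inf (ereal ` S)" "s \<in> S" "S \<subseteq> TT"
    using assms by (auto simp: time_values_def)
  then show ?thesis unfolding horizon_def
    by (metis INF_lower SUP_upper order_trans subsetD)
qed simp

lemma stopping_time_le_horizon:
  "\<tau> \<in> stopping_times M TT Fil \<Longrightarrow> \<omega> \<in> space M \<Longrightarrow> \<tau> \<omega> \<le> horizon TT"
  by (auto simp: stopping_times_def intro: time_values_le_horizon)

lemma time_values_INF:
  assumes x: "\<And>n :: nat. x n \<in> time_values TT"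
  shows "(INF n. x n) \<in> time_values TT"
proof (cases "\<forall>n. x n = horizon TT")
  case True
  then show ?thesis by (simp add: time_values_def)
next
  case False
  define N where "N = {n. x n \<noteq> horizon TT}"
  obtain m where "m \<in> N" using False by (auto simp: N_def)
  have "\<forall>n\<in>N. \<exists>S. S \<noteq> {} \<and> S \<subseteq> TT \<and> x n = Inf (ereal ` S)"
  proof
    fix n assume "n \<in> N"
    with x[of n] have "x n \<in> {Inf (ereal ` S) | S. S \<noteq> {} \<and> S \<subseteq> TT}"
      unfolding time_values_def N_def by blast
    then show "\<exists>S. S \<noteq> {} \<and> S \<subseteq> TT \<and> x n = Inf (ereal ` S)" by auto
  qed
  from bchoice[OF this] obtain S
    where S: "\<And>n. n \<in> N \<Longrightarrow> S n \<noteq> {} \<and> S n \<subseteq> TT \<and> x n = Inf (ereal ` S n)"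
    by auto
  \<comment> \<open>Indices with value the horizon contribute nothing to the infimum, since some other value
    occurs; the infimum of the others is the infimum of the union of the sets \<open>S n\<close>.\<close>
  have "(INF n. x n) = (INF n\<in>N. x n)"
  proof (rule antisym)
    show "(INF n. x n) \<le> (INF n\<in>N. x n)" by (rule INF_superset_mono) auto
    show "(INF n\<in>N. x n) \<le> (INF n. x n)"
    proof (rule INF_greatest)
      fix n
      show "(INF n\<in>N. x n) \<le> x n"
      proof (cases "n \<in> N")
        case False
        then have "x m \<le> x n" using time_values_le_horizon[OF x[of m]] by (simp add: N_def)
        with \<open>m \<in> N\<close> show ?thesis by (rule INF_lower2)
      qed (rule INF_lower)
    qed
  qed
  also have "\<dots> = (INF n\<in>N. Inf (ereal ` S n))" by (rule INF_cong[OF refl]) (simp add: S)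
  also have "\<dots> = Inf (ereal ` (\<Union>n\<in>N. S n))"
  proof (intro antisym INF_greatest)
    show "(INF n\<in>N. Inf (ereal ` S n)) \<le> ereal s" if "s \<in> (\<Union>n\<in>N. S n)" for s
    proof -
      obtain n where "n \<in> N" "s \<in> S n" using \<open>s \<in> (\<Union>n\<in>N. S n)\<close> by blast
      then show ?thesis by (auto intro!: INF_lower2[of n] INF_lower2[of s])
    qed
    show "Inf (ereal ` (\<Union>n\<in>N. S n)) \<le> ereal s" if "n \<in> N" "s \<in> S n" for n s
      using that by (intro INF_lower UN_I)
  qed
  finally have eq: "(INF n. x n) = Inf (ereal ` (\<Union>n\<in>N. S n))" .
  have "(\<Union>n\<in>N. S n) \<noteq> {}" "(\<Union>n\<in>N. S n) \<subseteq> TT"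
    using \<open>m \<in> N\<close> S by fast+
  then show ?thesis
    unfolding time_values_def eq by (intro insertI2 CollectI exI[of _ "\<Union>n\<in>N. S n"]) blast
qed

text \<open>A gap of \<open>TT\<close> to the right of \<open>t\<close> is a gap of all possible values, the added infima and the
  horizon included.\<close>

lemma time_values_gap:
  assumes gap: "\<And>s. s \<in> TT \<Longrightarrow> t < s \<Longrightarrow> t + e \<le> s"
    and x: "x \<in> time_values TT" "ereal t < x"
  shows "ereal (t + e) \<le> x"
proof (cases "x = horizon TT")
  case True
  then obtain s where "s \<in> TT" "ereal t < ereal s"
    using x(2) unfolding horizon_def by (auto simp: less_SUP_iff)
  then have "ereal (t + e) \<le> ereal s" using gap by simp
  also have "ereal s \<le> horizon TT" unfolding horizon_def by (rule SUP_upper) fact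
  finally show ?thesis using True by simp
next
  case False
  then obtain S where S: "S \<subseteq> TT" "x = Inf (ereal ` S)"
    using x(1) by (auto simp: time_values_def)
  have "ereal t < ereal s" if "s \<in> S" for s
    using x(2) INF_lower[OF that, of ereal] unfolding S(2) by (rule less_le_trans)
  then show ?thesis unfolding S(2) using S(1) gap by (intro INF_greatest) auto
qed

locale filtered_prob_space = prob_space M for M :: "'a measure" +
  fixes TT :: "real set" and Fil :: "real \<Rightarrow> 'a measure"
  assumes filtration: "filtration_on M TT Fil"
    and right_continuous: "right_continuous_filtration TT Fil"
begin

abbreviation ST where "ST \<equiv> stopping_times M TT Fil"

lemma space_Fil: "t \<in> TT \<Longrightarrow> space (Fil t) = space M"
  using filtration unfolding filtration_on_def subalgebra_def by blast

lemma sets_Fil_mono: "s \<in> TT \<Longrightarrow> t \<in> TT \<Longrightarrow> s \<le> t \<Longrightarrow> sets (Fil s) \<subseteq> sets (Fil t)"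
  using filtration unfolding filtration_on_def subalgebra_def by blast

lemma stopping_time_sets:
  assumes "\<tau> \<in> ST" "s \<in> TT" "t \<in> TT" "s \<le> t"
  shows "{\<omega>\<in>space M. \<tau> \<omega> \<le> ereal s} \<in> sets (Fil t)"
proof -
  have "{\<omega>\<in>space M. \<tau> \<omega> \<le> ereal s} \<in> sets (Fil s)"
    using assms(1,2) by (simp add: stopping_times_def)
  then show ?thesis using sets_Fil_mono[OF assms(2-4)] by (rule subsetD[rotated])
qed

lemma horizon_stopping_time: "(\<lambda>_. horizon TT) \<in> ST"
proof -
  have "(\<lambda>_. horizon TT) \<in> borel_measurable M" by (rule borel_measurable_const)
  moreover have "{\<omega> \<in> space M. horizon TT \<le> ereal t} \<in> sets (Fil t)" if "t \<in> TT" for t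
    using sets.top[of "Fil t"] unfolding space_Fil[OF that]
    by (cases "horizon TT \<le> ereal t") simp_all
  moreover have "horizon TT \<in> time_values TT" unfolding time_values_def by (rule insertI1)
  ultimately show ?thesis unfolding stopping_times_def by blast
qed

text \<open>If \<open>t\<close> is a limit of later time points, the infimum is at most \<open>t\<close> exactly if for every later
  \<open>s\<close> some term is at most \<open>s\<close>, an event known immediately after \<open>t\<close>. Otherwise \<open>t\<close> is followed by a
  gap, and then some term has to be at most \<open>t\<close> itself.\<close>

lemma stopping_time_INF:
  fixes X :: "nat \<Rightarrow> 'a \<Rightarrow> ereal"
  assumes X: "\<And>n. X n \<in> ST"
  shows "(\<lambda>\<omega>. INF n. X n \<omega>) \<in> ST"
proof -
  have [measurable]: "X n \<in> borel_measurable M" for n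
    by (rule stopping_times_measurable) (rule X)
  have in_values: "X n \<omega> \<in> time_values TT" if "\<omega> \<in> space M" for n \<omega>
    using X[of n] that unfolding stopping_times_def by blast
  have "{\<omega>\<in>space M. (INF n. X n \<omega>) \<le> ereal t} \<in> sets (Fil t)" (is "?A \<in> _") if t: "t \<in> TT" for t
  proof (cases "\<forall>e>0. \<exists>s\<in>TT. t < s \<and> s < t + e")
    case True
    have "\<forall>k. \<exists>s. s \<in> TT \<and> t < s \<and> s < t + inverse (real (Suc k))"
    proof
      fix k
      have "0 < inverse (real (Suc k))" by simp
      with True show "\<exists>s. s \<in> TT \<and> t < s \<and> s < t + inverse (real (Suc k))" by blast
    qed
    from choice[OF this] obtain u where u: "\<And>k. u k \<in> TT" "\<And>k. t < u k"
      "\<And>k. u k < t + inverse (real (Suc k))" by blast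
    have "?A \<in> sets (Fil s)" if s: "s \<in> TT" "t < s" for s
    proof -
      \<comment> \<open>Times between \<open>t\<close> and \<open>s\<close> with limit \<open>t\<close>.\<close>
      define w where "w k = min (u k) s" for k
      have w: "w k \<in> TT" "t < w k" "w k \<le> s" "w k < t + inverse (real (Suc k))" for k
        using u[of k] s by (auto simp only: w_def min_def split: if_split)
      have "?A = (\<Inter>k. \<Union>n. {\<omega>\<in>space M. X n \<omega> \<le> ereal (w k)})"
      proof (intro equalityI subsetI)
        fix \<omega> assume \<omega>: "\<omega> \<in> ?A"
        have "\<exists>n. X n \<omega> \<le> ereal (w k)" for k
        proof -
          have "(INF n. X n \<omega>) \<le> ereal t" using \<omega> by simp
          also have "ereal t < ereal (w k)" using w(2) by simp
          finally show ?thesis unfolding INF_less_iff using less_imp_le by blast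
        qed
        then show "\<omega> \<in> (\<Inter>k. \<Union>n. {\<omega>\<in>space M. X n \<omega> \<le> ereal (w k)})" using \<omega> by auto
      next
        fix \<omega> assume \<omega>: "\<omega> \<in> (\<Inter>k. \<Union>n. {\<omega>\<in>space M. X n \<omega> \<le> ereal (w k)})"
        have "(INF n. X n \<omega>) \<le> ereal (w k)" for k
        proof -
          obtain n where "X n \<omega> \<le> ereal (w k)" using \<omega> by blast
          then show ?thesis by (rule INF_lower2[OF UNIV_I])
        qed
        moreover have "\<exists>k. w k \<le> t + e" if "e > 0" for e
        proof -
          obtain k where "inverse (real (Suc k)) < e" using reals_Archimedean \<open>e > 0\<close> by blast
          with w(4)[of k] have "w k \<le> t + e" by linarith
          then show ?thesis ..
        qed
        ultimately have "(INF n. X n \<omega>) \<le> ereal (t + e)" if "e > 0" for e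
          using that by (meson ereal_less_eq(3) order_trans)
        then have "(INF n. X n \<omega>) \<le> ereal t" by (simp add: ereal_le_epsilon2)
        then show "\<omega> \<in> ?A" using \<omega> by auto
      qed
      also have "\<dots> \<in> sets (Fil s)"
      proof (rule sets.countable_INT)
        have "{\<omega>\<in>space M. X n \<omega> \<le> ereal (w k)} \<in> sets (Fil s)" for n k
          by (rule stopping_time_sets[OF X w(1) s(1) w(3)])
        then show "range (\<lambda>k. \<Union>n. {\<omega>\<in>space M. X n \<omega> \<le> ereal (w k)}) \<subseteq> sets (Fil s)"
          by blast
      qed simp
      finally show ?thesis .
    qed
    then have "?A \<in> (\<Inter>s\<in>{s\<in>TT. t < s}. sets (Fil s))" by auto
    also have "\<dots> = sets (Fil t)"
      using right_continuous t True by (simp add: right_continuous_filtration_def)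
    finally show ?thesis .
  next
    case False
    then obtain e where "e > 0" and gap: "\<not> (\<exists>s\<in>TT. t < s \<and> s < t + e)" by blast
    have e: "t + e \<le> s" if "s \<in> TT" "t < s" for s
    proof (rule ccontr)
      assume "\<not> t + e \<le> s"
      with that gap show False by auto
    qed
    have "(INF n. X n \<omega>) \<le> ereal t \<longleftrightarrow> (\<exists>n. X n \<omega> \<le> ereal t)" if \<omega>: "\<omega> \<in> space M" for \<omega>
    proof
      assume "(INF n. X n \<omega>) \<le> ereal t"
      also have "ereal t < ereal (t + e)" using \<open>e > 0\<close> by simp
      finally obtain n where "X n \<omega> < ereal (t + e)" unfolding INF_less_iff by blast
      then have "X n \<omega> \<le> ereal t"
        using time_values_gap[OF e in_values[OF \<omega>, of n]] by (meson not_le)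
      then show "\<exists>n. X n \<omega> \<le> ereal t" ..
    next
      assume "\<exists>n. X n \<omega> \<le> ereal t"
      then show "(INF n. X n \<omega>) \<le> ereal t" using INF_lower2[OF UNIV_I] by metis
    qed
    then have "?A = (\<Union>n. {\<omega>\<in>space M. X n \<omega> \<le> ereal t})" by auto
    also have "\<dots> \<in> sets (Fil t)"
      using stopping_time_sets[OF X t t order_refl] by blast
    finally show ?thesis .
  qed
  moreover have "(\<lambda>\<omega>. INF n. X n \<omega>) \<in> borel_measurable M" by measurable
  moreover have "(INF n. X n \<omega>) \<in> time_values TT" if "\<omega> \<in> space M" for \<omega>
    using in_values[OF that] by (rule time_values_INF)
  ultimately show ?thesis
    unfolding stopping_times_def by blast
qed

lemma chain_ess_inf_stopping_time:
  assumes "C \<subseteq> ST" "C \<noteq> {}" "totally_ordered_ae M C"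
  obtains \<sigma> where "\<sigma> \<in> ST" "is_ess_inf M C \<sigma>"
proof -
  have "C \<subseteq> borel_measurable M" using assms(1) stopping_times_measurable by blast
  then obtain X :: "nat \<Rightarrow> 'a \<Rightarrow> ereal"
    where "range X \<subseteq> C" and inf: "is_ess_inf M C (\<lambda>\<omega>. INF n. X n \<omega>)"
    using chain_ess_inf_sequence[OF prob_space_axioms] assms(2,3) by metis
  then have "(\<lambda>\<omega>. INF n. X n \<omega>) \<in> ST" using assms(1) by (intro stopping_time_INF) auto
  then show thesis using inf by (rule that)
qed

end

section \<open>The map \<open>F\<close>\<close>

lemma stop_map_le: "stop_map M TT Fil J \<rho> \<omega> \<le> \<rho> \<omega>"
  by (simp add: stop_map_def)

text \<open>A time \<open>t\<close> that qualifies for \<open>\<rho>\<close> qualifies for \<open>\<sigma>\<close> if \<open>t < \<sigma>\<close>, because the competitors at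
  \<open>\<sigma>\<close> are competitors at \<open>\<rho>\<close>; and if \<open>\<sigma> \<le> t\<close>, then \<open>F \<sigma> \<le> \<sigma> \<le> t\<close> anyway. Competitors are
  bounded almost surely and not at the given \<open>\<omega>\<close>, so one exceptional null set serves all \<open>t\<close>.\<close>

lemma stop_map_mono:
  assumes le: "AE \<omega> in M. \<sigma> \<omega> \<le> \<rho> \<omega>"
  shows "AE \<omega> in M. stop_map M TT Fil J \<sigma> \<omega> \<le> stop_map M TT Fil J \<rho> \<omega>"
  using le
proof eventually_elim
  case (elim \<omega>)
  have competitor: "AE \<omega>' in M. \<tau> \<omega>' \<le> max (\<rho> \<omega>') (ereal t)"
    if "AE \<omega>' in M. \<tau> \<omega>' \<le> max (\<sigma> \<omega>') (ereal t)" for \<tau> t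
    using that le by eventually_elim (auto simp: max_def split: if_splits)
  show ?case
    unfolding stop_map_def[of M TT Fil J \<rho>]
  proof (intro min.boundedI Inf_greatest)
    show "stop_map M TT Fil J \<sigma> \<omega> \<le> \<rho> \<omega>"
      using stop_map_le elim by (rule order_trans)
    fix x
    assume "x \<in> {ereal t | t. t \<in> TT \<and> ereal t < \<rho> \<omega> \<and>
            (\<forall>\<tau>\<in>stopping_times_from M TT Fil (\<lambda>_. ereal t).
               (AE \<omega>' in M. \<tau> \<omega>' \<le> max (\<rho> \<omega>') (ereal t)) \<and> ereal t < \<tau> \<omega> \<longrightarrow>
               J (\<lambda>_. ereal t) t \<omega> > J \<tau> t \<omega>)}"
    then obtain t where t: "x = ereal t" "t \<in> TT"
      "\<forall>\<tau>\<in>stopping_times_from M TT Fil (\<lambda>_. ereal t).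
               (AE \<omega>' in M. \<tau> \<omega>' \<le> max (\<rho> \<omega>') (ereal t)) \<and> ereal t < \<tau> \<omega> \<longrightarrow>
               J (\<lambda>_. ereal t) t \<omega> > J \<tau> t \<omega>" by blast
    show "stop_map M TT Fil J \<sigma> \<omega> \<le> x"
    proof (cases "ereal t < \<sigma> \<omega>")
      case True
      then show ?thesis
        unfolding stop_map_def t(1) using t(2,3) competitor
        by (intro min.coboundedI1 Inf_lower) blast
    next
      case False
      then have "\<sigma> \<omega> \<le> x" using t(1) by simp
      with stop_map_le show ?thesis by (rule order_trans)
    qed
  qed
qed

section \<open>The delimiting set\<close>

locale stopping_preference = filtered_prob_space M TT Fil
  for M :: "'a measure" and TT Fil +
  fixes J :: "('a \<Rightarrow> ereal) \<Rightarrow> real \<Rightarrow> 'a \<Rightarrow> real"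
  assumes stop_map_into: "\<forall>\<rho>\<in>stopping_times M TT Fil. \<exists>\<sigma>\<in>stopping_times M TT Fil.
           AE \<omega> in M. \<sigma> \<omega> = stop_map M TT Fil J \<rho> \<omega>"
begin

abbreviation F where "F \<equiv> stop_map M TT Fil J"

abbreviation \<D> where "\<D> \<equiv> delimiting_set M TT Fil J"

abbreviation le_ae :: "('a \<Rightarrow> ereal) \<Rightarrow> ('a \<Rightarrow> ereal) \<Rightarrow> bool" (infix "\<preceq>" 50)
  where "\<sigma> \<preceq> \<tau> \<equiv> AE \<omega> in M. \<sigma> \<omega> \<le> \<tau> \<omega>"

lemma le_ae_trans [trans]: "\<rho> \<preceq> \<sigma> \<Longrightarrow> \<sigma> \<preceq> \<tau> \<Longrightarrow> \<rho> \<preceq> \<tau>"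
  by (erule (1) eventually_elim2) simp

lemma eq_ae_le_ae:
  assumes "AE \<omega> in M. \<sigma> \<omega> = \<tau> \<omega>"
  shows "\<sigma> \<preceq> \<tau>" "\<tau> \<preceq> \<sigma>"
proof -
  show "\<sigma> \<preceq> \<tau>" using assms by eventually_elim simp
  show "\<tau> \<preceq> \<sigma>" using assms by eventually_elim simp
qed

lemma le_ae_horizon: "\<tau> \<in> ST \<Longrightarrow> \<tau> \<preceq> (\<lambda>_. horizon TT)"
  by (rule AE_I2) (rule stopping_time_le_horizon)

lemma admissible_stopping_times: "admissible M TT Fil J ST"
  unfolding admissible_def
  using horizon_stopping_time stop_map_into chain_ess_inf_stopping_time by blast

text \<open>Different admissible sets may name different representatives of \<open>F \<rho>\<close> and of an essential
  infimum; these are almost surely equal, so that every admissible set contains all of them.\<close>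

lemma admissible_delimiting_set: "admissible M TT Fil J \<D>"
proof -
  have sub: "\<D> \<subseteq> ST"
    unfolding delimiting_set_def using admissible_stopping_times by blast
  have closed: "\<tau> \<in> \<D>" if "\<sigma> \<in> \<D>" "\<tau> \<in> ST" "AE \<omega> in M. \<tau> \<omega> = \<sigma> \<omega>" for \<sigma> \<tau>
    using that unfolding delimiting_set_def admissible_def by blast
  have top: "(\<lambda>_. horizon TT) \<in> \<D>"
    unfolding delimiting_set_def admissible_def by blast
  have step: "\<exists>\<sigma>\<in>\<D>. AE \<omega> in M. \<sigma> \<omega> = F \<rho> \<omega>" if \<rho>: "\<rho> \<in> \<D>" for \<rho>
  proof -
    obtain \<sigma> where \<sigma>: "\<sigma> \<in> ST" "AE \<omega> in M. \<sigma> \<omega> = F \<rho> \<omega>"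
      using stop_map_into sub \<rho> by blast
    have "\<sigma> \<in> B" if B: "admissible M TT Fil J B" for B
    proof -
      have "\<rho> \<in> B" using \<rho> B by (auto simp: delimiting_set_def)
      then obtain \<sigma>' where \<sigma>': "\<sigma>' \<in> B" "AE \<omega> in M. \<sigma>' \<omega> = F \<rho> \<omega>"
        using B unfolding admissible_def by blast
      have "AE \<omega> in M. \<sigma> \<omega> = \<sigma>' \<omega>" using \<sigma>(2) \<sigma>'(2) by eventually_elim simp
      then show ?thesis using B \<sigma>(1) \<sigma>'(1) unfolding admissible_def by blast
    qed
    then show ?thesis using \<sigma>(2) by (auto simp: delimiting_set_def)
  qed
  have inf: "\<exists>\<sigma>\<in>\<D>. is_ess_inf M C \<sigma>"
    if C: "C \<subseteq> \<D>" "C \<noteq> {}" "totally_ordered_ae M C" for C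
  proof -
    obtain \<sigma> where \<sigma>: "\<sigma> \<in> ST" "is_ess_inf M C \<sigma>"
      using chain_ess_inf_stopping_time[OF _ C(2,3)] C(1) sub by blast
    have "\<sigma> \<in> B" if B: "admissible M TT Fil J B" for B
    proof -
      have "C \<subseteq> B" using C(1) B by (auto simp: delimiting_set_def)
      then obtain \<sigma>' where \<sigma>': "\<sigma>' \<in> B" "is_ess_inf M C \<sigma>'"
        using B C(2,3) unfolding admissible_def by blast
      then show ?thesis
        using B \<sigma>(1) is_ess_inf_unique[OF \<sigma>(2) \<sigma>'(2)] unfolding admissible_def by blast
    qed
    then show ?thesis using \<sigma>(2) by (auto simp: delimiting_set_def)
  qed
  show ?thesis unfolding admissible_def using sub closed top step inf by blast
qed

lemma delimiting_sub: "\<D> \<subseteq> ST"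
  using admissible_delimiting_set by (simp add: admissible_def)

lemma delimiting_cong: "\<sigma> \<in> \<D> \<Longrightarrow> \<tau> \<in> ST \<Longrightarrow> AE \<omega> in M. \<tau> \<omega> = \<sigma> \<omega> \<Longrightarrow> \<tau> \<in> \<D>"
  using admissible_delimiting_set unfolding admissible_def by blast

lemma delimiting_horizon: "(\<lambda>_. horizon TT) \<in> \<D>"
  using admissible_delimiting_set by (simp add: admissible_def)

lemma delimiting_step:
  assumes "\<rho> \<in> \<D>" obtains \<sigma> where "\<sigma> \<in> \<D>" "AE \<omega> in M. \<sigma> \<omega> = F \<rho> \<omega>"
  using admissible_delimiting_set assms unfolding admissible_def by blast

lemma delimiting_inf:
  assumes "C \<subseteq> \<D>" "C \<noteq> {}" "totally_ordered_ae M C"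
  obtains \<sigma> where "\<sigma> \<in> \<D>" "is_ess_inf M C \<sigma>"
  using admissible_delimiting_set assms unfolding admissible_def by blast

text \<open>Minimality of \<open>\<D>\<close> as transfinite induction along the iteration of \<open>F\<close>.\<close>

lemma delimiting_induct [consumes 1, case_names cong horizon step inf]:
  assumes "\<rho> \<in> \<D>"
    and cong: "\<And>\<sigma> \<tau>. P \<sigma> \<Longrightarrow> AE \<omega> in M. \<tau> \<omega> = \<sigma> \<omega> \<Longrightarrow> P \<tau>"
    and horizon: "P (\<lambda>_. horizon TT)"
    and step: "\<And>\<rho>. \<rho> \<in> \<D> \<Longrightarrow> P \<rho> \<Longrightarrow> P (F \<rho>)"
    and inf: "\<And>C \<sigma>. C \<subseteq> \<D> \<Longrightarrow> C \<noteq> {} \<Longrightarrow> (\<And>\<rho>. \<rho> \<in> C \<Longrightarrow> P \<rho>) \<Longrightarrow> is_ess_inf M C \<sigma> \<Longrightarrow> P \<sigma>"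
  shows "P \<rho>"
proof -
  define B where "B = {\<rho>\<in>\<D>. P \<rho>}"
  have B: "\<rho> \<in> B \<longleftrightarrow> \<rho> \<in> \<D> \<and> P \<rho>" for \<rho> by (simp add: B_def)
  have "B \<subseteq> ST" using delimiting_sub unfolding B_def by blast
  moreover have "\<forall>\<sigma>\<in>B. \<forall>\<tau>\<in>ST. (AE \<omega> in M. \<tau> \<omega> = \<sigma> \<omega>) \<longrightarrow> \<tau> \<in> B"
  proof (intro ballI impI)
    fix \<sigma> \<tau> assume \<sigma>: "\<sigma> \<in> B" "\<tau> \<in> ST" "AE \<omega> in M. \<tau> \<omega> = \<sigma> \<omega>"
    then have "\<tau> \<in> \<D>" using delimiting_cong unfolding B by blast
    moreover have "P \<tau>" using \<sigma>(1,3) cong[of \<sigma> \<tau>] unfolding B by blast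
    ultimately show "\<tau> \<in> B" unfolding B ..
  qed
  moreover have "(\<lambda>_. horizon TT) \<in> B" using delimiting_horizon horizon unfolding B ..
  moreover have "\<forall>\<rho>\<in>B. \<exists>\<sigma>\<in>B. AE \<omega> in M. \<sigma> \<omega> = F \<rho> \<omega>"
  proof
    fix \<rho> assume "\<rho> \<in> B"
    then have \<rho>: "\<rho> \<in> \<D>" "P (F \<rho>)" using step[of \<rho>] unfolding B by blast+
    obtain \<sigma> where \<sigma>: "\<sigma> \<in> \<D>" "AE \<omega> in M. \<sigma> \<omega> = F \<rho> \<omega>" using delimiting_step[OF \<rho>(1)] .
    then have "\<sigma> \<in> B" using cong[OF \<rho>(2), of \<sigma>] unfolding B by blast
    with \<sigma>(2) show "\<exists>\<sigma>\<in>B. AE \<omega> in M. \<sigma> \<omega> = F \<rho> \<omega>" by blast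
  qed
  moreover have "\<exists>\<sigma>\<in>B. is_ess_inf M C \<sigma>"
    if C: "C \<subseteq> B" "C \<noteq> {}" "totally_ordered_ae M C" for C
  proof -
    have sub: "C \<subseteq> \<D>" using C(1) unfolding B_def by blast
    obtain \<sigma> where \<sigma>: "\<sigma> \<in> \<D>" "is_ess_inf M C \<sigma>" using delimiting_inf[OF sub C(2,3)] .
    have "P \<rho>" if "\<rho> \<in> C" for \<rho> using C(1) that unfolding B_def by blast
    then have "P \<sigma>" by (rule inf[OF sub C(2) _ \<sigma>(2)])
    with \<sigma> show ?thesis unfolding B_def by blast
  qed
  ultimately have "admissible M TT Fil J B" unfolding admissible_def by blast
  then have "\<rho> \<in> B" using assms(1) by (auto simp: delimiting_set_def)
  then show ?thesis by (simp add: B)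
qed

lemma ess_inf_comparable:
  assumes "is_ess_inf M C \<sigma>" "\<tau> \<in> borel_measurable M" "\<And>\<rho>. \<rho> \<in> C \<Longrightarrow> \<rho> \<preceq> \<tau> \<or> \<tau> \<preceq> \<rho>"
  shows "\<sigma> \<preceq> \<tau> \<or> \<tau> \<preceq> \<sigma>"
proof (cases "\<exists>\<rho>\<in>C. \<rho> \<preceq> \<tau>")
  case True
  then obtain \<rho> where "\<rho> \<in> C" and \<rho>: "\<rho> \<preceq> \<tau>" ..
  then have "\<sigma> \<preceq> \<rho>" using assms(1) unfolding is_ess_inf_def by blast
  then have "\<sigma> \<preceq> \<tau>" using \<rho> by (rule le_ae_trans)
  then show ?thesis ..
next
  case False
  then have "\<forall>\<rho>\<in>C. \<tau> \<preceq> \<rho>" using assms(3) by blast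
  then show ?thesis using assms(1,2) unfolding is_ess_inf_def by blast
qed

text \<open>The inductive step for \<open>delimiting_chain\<close>: if \<open>c\<close> is comparable with all of \<open>\<D>\<close>, so is
  \<open>F c\<close>. By induction on \<open>x\<close>, suppose \<open>F c \<le> x\<close>, the other case being clear from \<open>F x \<le> x\<close>.
  If \<open>c \<le> x\<close>, then \<open>F c \<le> F x\<close>; and if \<open>x \<le> c\<close>, then \<open>F x \<le> F c\<close>.\<close>

lemma stop_map_comparable:
  assumes c: "c \<in> \<D>" "\<And>x. x \<in> \<D> \<Longrightarrow> x \<preceq> c \<or> c \<preceq> x" and "x \<in> \<D>"
  shows "x \<preceq> F c \<or> F c \<preceq> x"
proof -
  obtain d where d: "d \<in> \<D>" "AE \<omega> in M. d \<omega> = F c \<omega>"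
    using delimiting_step[OF c(1)] .
  note dF = eq_ae_le_ae[OF d(2)]
  have d_ST: "d \<in> ST" using d(1) delimiting_sub by blast
  from \<open>x \<in> \<D>\<close> have "x \<preceq> d \<or> d \<preceq> x"
  proof (induction x rule: delimiting_induct)
    case (cong \<sigma> \<tau>)
    then show ?case
      using le_ae_trans[OF eq_ae_le_ae(1)[OF cong.hyps]] le_ae_trans[OF _ eq_ae_le_ae(2)[OF cong.hyps]]
      by blast
  next
    case horizon
    show ?case using le_ae_horizon[OF d_ST] ..
  next
    case (step \<rho>)
    have F_le: "F \<rho> \<preceq> \<rho>" by (rule AE_I2) (rule stop_map_le)
    show ?case
    proof (cases "\<rho> \<preceq> d")
      case True
      then show ?thesis using le_ae_trans[OF F_le] by blast
    next
      case False
      from c(2)[OF step.hyps] show ?thesis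
      proof
        assume "\<rho> \<preceq> c"
        then have "F \<rho> \<preceq> F c" by (rule stop_map_mono)
        then show ?thesis using le_ae_trans[OF _ dF(2)] by blast
      next
        assume "c \<preceq> \<rho>"
        then have "F c \<preceq> F \<rho>" by (rule stop_map_mono)
        then show ?thesis using le_ae_trans[OF dF(1)] by blast
      qed
    qed
  next
    case (inf C \<sigma>)
    show ?case
      by (rule ess_inf_comparable[OF inf.hyps(3) stopping_times_measurable[OF d_ST]]) (rule inf.IH)
  qed
  then show ?thesis using le_ae_trans[OF _ dF(1)] le_ae_trans[OF dF(2)] by blast
qed

lemma delimiting_chain: "totally_ordered_ae M \<D>"
proof -
  have "\<forall>x\<in>\<D>. x \<preceq> c \<or> c \<preceq> x" if "c \<in> \<D>" for c
    using that
  proof (induction c rule: delimiting_induct)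
    case (cong \<sigma> \<tau>)
    then show ?case
      using le_ae_trans[OF eq_ae_le_ae(1)[OF cong.hyps]] le_ae_trans[OF _ eq_ae_le_ae(2)[OF cong.hyps]]
      by blast
  next
    case horizon
    then show ?case using le_ae_horizon delimiting_sub by blast
  next
    case (step \<rho>)
    then show ?case using stop_map_comparable by blast
  next
    case (inf C \<sigma>)
    show ?case
    proof
      fix x assume "x \<in> \<D>"
      then have "x \<in> borel_measurable M" using delimiting_sub stopping_times_measurable by blast
      moreover have "\<rho> \<preceq> x \<or> x \<preceq> \<rho>" if "\<rho> \<in> C" for \<rho> using inf.IH that \<open>x \<in> \<D>\<close> by blast
      ultimately have "\<sigma> \<preceq> x \<or> x \<preceq> \<sigma>" by (rule ess_inf_comparable[OF inf.hyps(3)])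
      then show "x \<preceq> \<sigma> \<or> \<sigma> \<preceq> x" by blast
    qed
  qed
  then show ?thesis unfolding totally_ordered_ae_def by blast
qed

lemma approachable_le_delimiting:
  assumes \<tau>: "\<tau> \<in> approachable_times M TT Fil J" and "\<rho> \<in> \<D>"
  shows "\<tau> \<preceq> \<rho>"
proof -
  have \<tau>_ST: "\<tau> \<in> ST" and \<tau>_F: "\<tau> \<preceq> F \<tau>"
    using \<tau> eq_ae_le_ae unfolding approachable_times_def by blast+
  from \<open>\<rho> \<in> \<D>\<close> show ?thesis
  proof (induction \<rho> rule: delimiting_induct)
    case (cong \<sigma> \<tau>')
    show ?case using cong.IH eq_ae_le_ae(2)[OF cong.hyps] by (rule le_ae_trans)
  next
    case horizon
    show ?case using \<tau>_ST by (rule le_ae_horizon)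
  next
    case (step \<rho>)
    note \<tau>_F
    also have "F \<tau> \<preceq> F \<rho>" using step.IH by (rule stop_map_mono)
    finally show ?case .
  next
    case (inf C \<sigma>)
    then show ?case using stopping_times_measurable[OF \<tau>_ST] unfolding is_ess_inf_def by blast
  qed
qed

lemma delimiting_ess_inf_greatest_approachable:
  obtains r where "r \<in> approachable_times M TT Fil J" "is_ess_inf M \<D> r"
    "is_ess_sup M (approachable_times M TT Fil J) r"
proof -
  obtain r where r: "r \<in> \<D>" "is_ess_inf M \<D> r"
    using delimiting_inf[OF order_refl _ delimiting_chain] delimiting_horizon by blast
  obtain s where s: "s \<in> \<D>" "AE \<omega> in M. s \<omega> = F r \<omega>" using delimiting_step[OF r(1)] .
  have "r \<preceq> s" using r(2) s(1) unfolding is_ess_inf_def by blast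
  with s(2) have "AE \<omega> in M. F r \<omega> = r \<omega>"
    by eventually_elim (use stop_map_le in \<open>metis antisym\<close>)
  then have r_app: "r \<in> approachable_times M TT Fil J"
    using r(1) delimiting_sub by (auto simp: approachable_times_def)
  moreover have "is_ess_sup M (approachable_times M TT Fil J) r"
    using r_app approachable_le_delimiting[OF _ r(1)] r(2)
    unfolding is_ess_sup_def is_ess_inf_def by blast
  ultimately show thesis using r(2) that by blast
qed

end

theorem theorem3p3:
  fixes M :: "'a measure" and TT :: "real set" and Fil :: "real \<Rightarrow> 'a measure"
    and J :: "('a \<Rightarrow> ereal) \<Rightarrow> real \<Rightarrow> 'a \<Rightarrow> real"
  assumes "prob_space M"
    and "TT \<subseteq> {0..}" and "0 \<in> TT"
    and "filtration_on M TT Fil" and "right_continuous_filtration TT Fil"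
    and "preference M TT Fil J"
    and stop_map_into: "\<forall>\<rho>\<in>stopping_times M TT Fil. \<exists>\<sigma>\<in>stopping_times M TT Fil.
           AE \<omega> in M. \<sigma> \<omega> = stop_map M TT Fil J \<rho> \<omega>"
  shows "AE \<omega> in M. ess_inf M (delimiting_set M TT Fil J) \<omega>
                   = ess_sup M (approachable_times M TT Fil J) \<omega>"
proof -
  interpret prob_space M by fact
  interpret stopping_preference M TT Fil J
    by unfold_locales (fact assms)+
  obtain r where inf: "is_ess_inf M \<D> r"
    and sup: "is_ess_sup M (approachable_times M TT Fil J) r"
    by (rule delimiting_ess_inf_greatest_approachable)
  have "is_ess_inf M \<D> (ess_inf M \<D>)"
    unfolding ess_inf_def using inf by (rule someI[of "is_ess_inf M \<D>"])
  with inf have "AE \<omega> in M. ess_inf M \<D> \<omega> = r \<omega>" by (metis is_ess_inf_unique)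
  moreover have "is_ess_sup M (approachable_times M TT Fil J)
      (ess_sup M (approachable_times M TT Fil J))"
    unfolding ess_sup_def using sup by (rule someI[of "is_ess_sup M (approachable_times M TT Fil J)"])
  with sup have "AE \<omega> in M. ess_sup M (approachable_times M TT Fil J) \<omega> = r \<omega>"
    by (metis is_ess_sup_unique)
  ultimately show ?thesis by eventually_elim simp
qed

end
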